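(* Let $E:\mathbb{R}^k\to\mathbb{R}$ be a $C^1$ function, $\overline{\nabla E}$ a discrete gradient of $\nabla E$, $\Delta t>0$, and let $\tilde B(\boldsymbol Y,\boldsymbol X)$ be a symmetric, negative semi-definite $k\times k$ matrix for all $\boldsymbol X,\boldsymbol Y\in\mathbb{R}^k$. Let $\boldsymbol X^n,\boldsymbol X^{n+1}\in\mathbb{R}^k$ be successive solutions of the scheme $$\frac{\boldsymbol X^{n+1}-\boldsymbol X^n}{\Delta t}=\tilde B(\boldsymbol X^{n+1},\boldsymbol X^n)\,\overline{\nabla E}(\boldsymbol X^{n+1},\boldsymbol X^n).$$ Then $E(\boldsymbol X^{n+1})\le E(\boldsymbol X^n)$. In addition, if $I:\mathbb{R}^k\to\mathbb{R}$ is a $C^1$ function and $\overline{\nabla I}$ is a discrete gradient of $\nabla I$ satisfying $$\overline{\nabla I}(\boldsymbol X^{n+1},\boldsymbol X^n)\perp\tilde B(\boldsymbol X^{n+1},\boldsymbol X^n)\,\overline{\nabla E}(\boldsymbol X^{n+1},\boldsymbol X^n),$$ then $I(\boldsymbol X^{n+1})=I(\boldsymbol X^n)$.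
   Context: A discrete gradient of $\nabla E$ is a map $\overline{\nabla E}:\mathbb{R}^k\times\mathbb{R}^k\to\mathbb{R}^k$ satisfying $\overline{\nabla E}(\boldsymbol Y,\boldsymbol X)^T(\boldsymbol Y-\boldsymbol X)=E(\boldsymbol Y)-E(\boldsymbol X)$ for all $\boldsymbol X,\boldsymbol Y\in\mathbb{R}^k$; similarly for $I$. (In the paper $\tilde B$ approximates a matrix field $B$ for which the scheme discretizes $\dot{\boldsymbol X}=B(\boldsymbol X)\nabla E(\boldsymbol X)$.) $\perp$ is orthogonality in the Euclidean inner product. *)

theory Defs
  imports "HOL-Analysis.Analysis"
begin

definition C1_function :: "('a::real_inner \<Rightarrow> real) \<Rightarrow> bool" where
  "C1_function f \<longleftrightarrow> (\<exists>g. (\<forall>x. GDERIV f x :> g x) \<and> continuous_on UNIV g)"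

(* As in the discrete gradient literature, the new state comes first: in "G Y X", Y follows X.
   Neither continuity of G nor the consistency condition that G X X is the gradient of f at X
   is part of the notion. *)
definition discrete_gradient ::
  "('a::real_inner \<Rightarrow> real) \<Rightarrow> ('a \<Rightarrow> 'a \<Rightarrow> 'a) \<Rightarrow> bool" where
  "discrete_gradient f G \<longleftrightarrow> (\<forall>X Y. G Y X \<bullet> (Y - X) = f Y - f X)"

definition symmetric_matrix :: "real^'k^'k \<Rightarrow> bool" where
  "symmetric_matrix A \<longleftrightarrow> transpose A = A"

definition negative_semidefinite :: "real^'k^'k \<Rightarrow> bool" where
  "negative_semidefinite A \<longleftrightarrow> (\<forall>v. v \<bullet> (A *v v) \<le> 0)"

end

theory Submission
  imports Defs
begin

text \<open>The scheme makes the step a positive multiple of \<open>?u\<close>, the matrix applied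
  to the discrete gradient of \<open>E\<close>. A discrete gradient obeys an exact chain rule along
  this step, so the change of any such function is \<Delta>t times the inner product of its discrete
  gradient with \<open>?u\<close>. For \<open>E\<close> that product is a value of a nonpositive
  quadratic form; for \<open>I\<close> it vanishes by orthogonality.\<close>

theorem lemma3p2:
  fixes E :: "real^'k \<Rightarrow> real"
    and dE :: "real^'k \<Rightarrow> real^'k \<Rightarrow> real^'k"
    and B :: "real^'k \<Rightarrow> real^'k \<Rightarrow> real^'k^'k"
    and \<Delta>t :: real
    and X\<^sub>n X\<^sub>n\<^sub>1 :: "real^'k"
  assumes "C1_function E"
    and "discrete_gradient E dE"
    and "\<Delta>t > 0"
    and "\<And>X Y. symmetric_matrix (B Y X)"
    and "\<And>X Y. negative_semidefinite (B Y X)"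
    and "(X\<^sub>n\<^sub>1 - X\<^sub>n) /\<^sub>R \<Delta>t = B X\<^sub>n\<^sub>1 X\<^sub>n *v dE X\<^sub>n\<^sub>1 X\<^sub>n"
  shows "E X\<^sub>n\<^sub>1 \<le> E X\<^sub>n \<and>
    (\<forall>(I :: real^'k \<Rightarrow> real) (dI :: real^'k \<Rightarrow> real^'k \<Rightarrow> real^'k).
       C1_function I \<longrightarrow> discrete_gradient I dI \<longrightarrow>
       orthogonal (dI X\<^sub>n\<^sub>1 X\<^sub>n) (B X\<^sub>n\<^sub>1 X\<^sub>n *v dE X\<^sub>n\<^sub>1 X\<^sub>n) \<longrightarrow>
       I X\<^sub>n\<^sub>1 = I X\<^sub>n)"
proof -
  let ?u = "B X\<^sub>n\<^sub>1 X\<^sub>n *v dE X\<^sub>n\<^sub>1 X\<^sub>n"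
  \<comment> \<open>Reading the scheme from right to left turns \<open>?u\<close> into the
    difference quotient, and \<Delta>t cancels because it is nonzero.\<close>
  have step: "X\<^sub>n\<^sub>1 - X\<^sub>n = \<Delta>t *\<^sub>R ?u"
    using assms(3) by (simp flip: assms(6))
  \<comment> \<open>The discrete form of d/dt f(X) = grad f(X) . X', kept general in
    \<open>f\<close> and \<open>G\<close> so that it serves both \<open>E\<close> and
    \<open>I\<close>.\<close>
  have increment: "f X\<^sub>n\<^sub>1 - f X\<^sub>n = \<Delta>t * (G X\<^sub>n\<^sub>1 X\<^sub>n \<bullet> ?u)"
    if "discrete_gradient f G" for f :: "real^'k \<Rightarrow> real" and G
  proof -
    have "f X\<^sub>n\<^sub>1 - f X\<^sub>n = G X\<^sub>n\<^sub>1 X\<^sub>n \<bullet> (X\<^sub>n\<^sub>1 - X\<^sub>n)"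
      using that by (simp add: discrete_gradient_def)
    then show ?thesis
      by (simp add: step)
  qed
  \<comment> \<open>Semidefiniteness is tested on the discrete gradient of \<open>E\<close>
    itself.\<close>
  have "dE X\<^sub>n\<^sub>1 X\<^sub>n \<bullet> ?u \<le> 0"
    using assms(5) by (simp add: negative_semidefinite_def)
  then have "E X\<^sub>n\<^sub>1 - E X\<^sub>n \<le> 0"
    using increment[OF assms(2)] assms(3) by (simp add: mult_nonneg_nonpos)
  moreover have "I X\<^sub>n\<^sub>1 = I X\<^sub>n"
    if "discrete_gradient I dI" and "orthogonal (dI X\<^sub>n\<^sub>1 X\<^sub>n) ?u" for I dI
    using increment[OF that(1)] that(2) by (simp add: orthogonal_def)
  ultimately show ?thesis
    by auto
qed

end
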